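(* Let $T$ be a left continuous t-norm on $[0,1]$ and $L$ be a right continuous t-conorm on $[0,\infty]$. Then $L\otimes T(f,g)\in\mathcal{D}^+_c$ for all $f\in\mathcal{D}^+$ and all $g\in\mathcal{D}^+_c$ if and only if $T$ is continuous and $L$ satisfies the cancellation law: for all $x,y,z\in[0,\infty]$, $L(x,y)=L(x,z)$ implies $x=\infty$ or $y=z$. In this case, $(\mathcal{D}^+_c,L\otimes T)$ forms an ideal of $(\mathcal{D}^+,L\otimes T)$.
   Context: A distance distribution function (d.d.f.) is an increasing (i.e. non-decreasing) function $f:[0,\infty]\to[0,1]$ with $f(0)=0$, $f(\infty)=1$ that is left continuous on the open interval $]0,\infty[$. $\Delta^+$ is the set of all d.d.f.'s, ordered pointwise; it is a complete lattice in which suprema of non-empty families are computed pointwise. $\mathcal{D}^+\subseteq\Delta^+$ is the set of all non-defective d.d.f.'s, i.e. those with $f(\infty^-)=\sup_{x<\infty}f(x)=1$. $\mathcal{D}^+_c\subseteq\mathcal{D}^+$ is the set of all d.d.f.'s that are continuous on $[0,\infty]$. For $r\in[0,\infty]$, $p\in[0,1]$, the step function $\varepsilon(r,p)\in\Delta^+$ is given by $\varepsilon(r,p)(\infty)=1$, $\varepsilon(r,p)(x)=p$ for $r<x<\infty$, and $\varepsilon(r,p)(x)=0$ for $x\le r$, $x<\infty$. A t-norm $T$ is an associative, commutative binary operation on $[0,1]$, increasing in each place, with identity $1$; it is left continuous (resp. continuous) if it is left continuous (resp. continuous) as a function $[0,1]^2\to[0,1]$ (left continuity is equivalent to preserving arbitrary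 suprema in each variable). A t-conorm $L$ on $[0,\infty]$ is an associative, commutative binary operation on $[0,\infty]$, increasing in each place, with identity $0$; it is right continuous if it is right continuous as a function $[0,\infty]^2\to[0,\infty]$ (equivalently, it preserves arbitrary infima in each variable). $L\otimes T$ is the binary operation on $\Delta^+$ that preserves arbitrary suprema in each variable and satisfies $L\otimes T(\varepsilon(r,p),\varepsilon(s,q))=\varepsilon(L(r,s),T(p,q))$ for all $r,s,p,q$; equivalently $L\otimes T(f,g)=\sup_{r,s\in[0,\infty]}\varepsilon(L(r,s),T(f(r),g(s)))$ (supremum in $\Delta^+$). $(\Delta^+,L\otimes T)$ is a commutative monoid with identity $\varepsilon(0,1)$. "Ideal" means semigroup ideal: a non-empty subset $I$ of a commutative semigroup $S$ such that the product of any element of $S$ with any element of $I$ is in $I$. *)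

theory Defs
  imports "HOL-Analysis.Analysis"
begin

definition ddf :: "(ennreal \<Rightarrow> real) set" where
  "ddf = {f. mono f \<and> range f \<subseteq> {0..1} \<and> f 0 = 0 \<and> f top = 1 \<and>
             (\<forall>x\<in>{0<..<top}. continuous (at_left x) f)}"

definition nondefective_ddf :: "(ennreal \<Rightarrow> real) set" where
  "nondefective_ddf = {f \<in> ddf. (SUP x\<in>{..<top}. f x) = 1}"

text \<open>Continuity on $[0,\infty]$ refers to the order topology of the type of extended
  non-negative reals, so it includes continuity at $\infty$.\<close>

definition continuous_ddf :: "(ennreal \<Rightarrow> real) set" where
  "continuous_ddf = {f \<in> nondefective_ddf. continuous_on UNIV f}"

definition step_ddf :: "ennreal \<Rightarrow> real \<Rightarrow> ennreal \<Rightarrow> real" where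
  "step_ddf r p x = (if x = top then 1 else if r < x then p else 0)"

text \<open>A t-norm is a total function on the reals of which only the values on $[0,1]^2$ matter.\<close>

definition t_norm :: "(real \<Rightarrow> real \<Rightarrow> real) \<Rightarrow> bool" where
  "t_norm T \<longleftrightarrow>
     (\<forall>x\<in>{0..1}. \<forall>y\<in>{0..1}. T x y \<in> {0..1}) \<and>
     (\<forall>x\<in>{0..1}. \<forall>y\<in>{0..1}. \<forall>z\<in>{0..1}. T (T x y) z = T x (T y z)) \<and>
     (\<forall>x\<in>{0..1}. \<forall>y\<in>{0..1}. T x y = T y x) \<and>
     (\<forall>x\<in>{0..1}. \<forall>y\<in>{0..1}. \<forall>z\<in>{0..1}. y \<le> z \<longrightarrow> T x y \<le> T x z \<and> T y x \<le> T z x) \<and>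
     (\<forall>x\<in>{0..1}. T 1 x = x \<and> T x 1 = x)"

text \<open>Joint left continuity: the limit at $(a,b)$ is taken through the points of $[0,1]^2$
  lying below $(a,b)$ in both coordinates.\<close>

definition left_continuous_t_norm :: "(real \<Rightarrow> real \<Rightarrow> real) \<Rightarrow> bool" where
  "left_continuous_t_norm T \<longleftrightarrow> t_norm T \<and>
     (\<forall>a\<in>{0..1}. \<forall>b\<in>{0..1}.
        continuous (at (a, b) within {0..a} \<times> {0..b}) (\<lambda>(x, y). T x y))"

definition continuous_t_norm :: "(real \<Rightarrow> real \<Rightarrow> real) \<Rightarrow> bool" where
  "continuous_t_norm T \<longleftrightarrow> t_norm T \<and> continuous_on ({0..1} \<times> {0..1}) (\<lambda>(x, y). T x y)"

definition t_conorm :: "(ennreal \<Rightarrow> ennreal \<Rightarrow> ennreal) \<Rightarrow> bool" where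
  "t_conorm L \<longleftrightarrow>
     (\<forall>x y z. L (L x y) z = L x (L y z)) \<and>
     (\<forall>x y. L x y = L y x) \<and>
     (\<forall>x y z. y \<le> z \<longrightarrow> L x y \<le> L x z \<and> L y x \<le> L z x) \<and>
     (\<forall>x. L 0 x = x \<and> L x 0 = x)"

definition right_continuous_t_conorm :: "(ennreal \<Rightarrow> ennreal \<Rightarrow> ennreal) \<Rightarrow> bool" where
  "right_continuous_t_conorm L \<longleftrightarrow> t_conorm L \<and>
     (\<forall>a b. continuous (at (a, b) within {a..} \<times> {b..}) (\<lambda>(x, y). L x y))"

definition cancellation_law :: "(ennreal \<Rightarrow> ennreal \<Rightarrow> ennreal) \<Rightarrow> bool" where
  "cancellation_law L \<longleftrightarrow> (\<forall>x y z. L x y = L x z \<longrightarrow> x = top \<or> y = z)"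

text \<open>$L \otimes T$. Suprema of non-empty families of d.d.f.'s are computed pointwise; for d.d.f.'s
  $f$, $g$ and a t-norm $T$ all values below lie in $[0,1]$, so the real supremum is a genuine one.\<close>

definition tensor_op ::
  "(ennreal \<Rightarrow> ennreal \<Rightarrow> ennreal) \<Rightarrow> (real \<Rightarrow> real \<Rightarrow> real) \<Rightarrow>
   (ennreal \<Rightarrow> real) \<Rightarrow> (ennreal \<Rightarrow> real) \<Rightarrow> ennreal \<Rightarrow> real" where
  "tensor_op L T f g x = (SUP (r, s)\<in>UNIV. step_ddf (L r s) (T (f r) (g s)) x)"

definition comm_semigroup_on :: "'a set \<Rightarrow> ('a \<Rightarrow> 'a \<Rightarrow> 'a) \<Rightarrow> bool" where
  "comm_semigroup_on S m \<longleftrightarrow>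
     (\<forall>a\<in>S. \<forall>b\<in>S. m a b \<in> S) \<and>
     (\<forall>a\<in>S. \<forall>b\<in>S. \<forall>c\<in>S. m (m a b) c = m a (m b c)) \<and>
     (\<forall>a\<in>S. \<forall>b\<in>S. m a b = m b a)"

definition semigroup_ideal :: "'a set \<Rightarrow> 'a set \<Rightarrow> ('a \<Rightarrow> 'a \<Rightarrow> 'a) \<Rightarrow> bool" where
  "semigroup_ideal I S m \<longleftrightarrow>
     comm_semigroup_on S m \<and> I \<subseteq> S \<and> I \<noteq> {} \<and> (\<forall>s\<in>S. \<forall>i\<in>I. m s i \<in> I)"

end

theory Submission
  imports Defs
begin

text \<open>For \<open>x < \<infinity>\<close> the value \<open>L \<otimes> T (f, g) (x)\<close> is the supremum of all \<open>T (f r) (g s)\<close> with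
  \<open>L r s < x\<close>. The strict inequality makes it left continuous in \<open>x\<close>, so the only issue is what
  happens when \<open>x\<close> is increased slightly: pairs \<open>(r, s)\<close> with \<open>L r s\<close> barely above \<open>x\<close> come in.

  Suppose that \<open>T\<close> is continuous and \<open>L\<close> is cancellative. Cancellation means that \<open>L\<close> is strictly
  increasing in each place as long as the other argument is finite, and right continuity makes this
  uniform: if \<open>a < b\<close> and \<open>x < \<infinity>\<close>, there is a single \<open>y > x\<close> such that \<open>L r b < y\<close>
  implies \<open>L r a < x\<close> for every \<open>r\<close> (lemma \<open>cancellation_uniform_gap\<close>). Hence a pair \<open>(r, s)\<close>
  that comes in below \<open>y\<close> can be replaced by one that was already present at \<open>x\<close>, at the price of
  moving \<open>s\<close> to the left. Continuity of \<open>g\<close> and uniform continuity of \<open>T\<close> make the loss in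
  \<open>T (f r) (g s)\<close> small, and only finitely many pairs \<open>(a, b)\<close> are needed, because the values
  of \<open>g\<close> lie in a bounded interval (lemma \<open>tensor_no_right_jump\<close>). Cancellation also keeps \<open>L r s\<close> finite for finite \<open>r\<close>, \<open>s\<close>, which preserves
  non-defectiveness.

  Conversely, products with well-chosen factors expose \<open>T\<close> and \<open>L\<close>. If \<open>f\<close> is constantly
  \<open>p\<close> on \<open>(0,1]\<close> and \<open>g\<close> is the identity on \<open>[0,1]\<close>, the product agrees on
  \<open>[0,1]\<close> with the section \<open>T p\<close>; so all sections are continuous, and for monotone functions of
  two variables this implies joint continuity. If \<open>L x y = L x z\<close> with \<open>x < \<infinity>\<close> and
  \<open>y < z\<close>, the product of \<open>\<epsilon>(x,1)\<close> with a continuous \<open>g\<close> climbing from \<open>0\<close> to \<open>1\<close>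
  between \<open>y\<close> and \<open>z\<close> takes no values strictly between \<open>0\<close> and \<open>1\<close>, so it
  is not continuous.

  For the ideal property it remains to see that the operation is associative and commutative, which
  follows by comparing strict upper level sets (lemmas \<open>less_tensor_iff\<close> and
  \<open>less_tensor_tensor_iff\<close>).\<close>

section \<open>Monotone functions on the extended half-line\<close>

lemma mono_left_continuous_iff:
  fixes f :: "ennreal \<Rightarrow> real"
  assumes "mono f" and "0 < x"
  shows "continuous (at_left x) f \<longleftrightarrow> (\<forall>c<f x. \<exists>y<x. c < f y)"
proof
  assume "continuous (at_left x) f"
  then have lim: "(f \<longlongrightarrow> f x) (at_left x)"
    by (simp add: continuous_within)
  show "\<forall>c<f x. \<exists>y<x. c < f y"
  proof (intro allI impI)
    fix c assume "c < f x"
    then have "eventually (\<lambda>y. c < f y) (at_left x)"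
      using lim by (rule order_tendstoD(1)[rotated])
    then obtain b where "b < x" and b: "\<And>y. b < y \<Longrightarrow> y < x \<Longrightarrow> c < f y"
      unfolding eventually_at_left[OF \<open>0 < x\<close>] by blast
    then show "\<exists>y<x. c < f y"
      using dense by blast
  qed
next
  assume r: "\<forall>c<f x. \<exists>y<x. c < f y"
  have "(f \<longlongrightarrow> f x) (at_left x)"
  proof (rule order_tendstoI)
    fix c assume "c < f x"
    then obtain b where "b < x" "c < f b"
      using r by blast
    then show "eventually (\<lambda>y. c < f y) (at_left x)"
      unfolding eventually_at_left[OF \<open>0 < x\<close>]
      using monoD[OF \<open>mono f\<close>] by (meson less_imp_le less_le_trans)
  next
    fix c assume "f x < c"
    then show "eventually (\<lambda>y. f y < c) (at_left x)"
      unfolding eventually_at_left[OF \<open>0 < x\<close>]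
      using monoD[OF \<open>mono f\<close>] \<open>0 < x\<close> by (meson le_less_trans less_imp_le)
  qed
  then show "continuous (at_left x) f"
    by (simp add: continuous_within)
qed

lemma mono_right_continuousI:
  fixes f :: "ennreal \<Rightarrow> real"
  assumes "mono f" and "x < top" and r: "\<And>c. f x < c \<Longrightarrow> \<exists>y>x. f y < c"
  shows "continuous (at_right x) f"
proof -
  have "(f \<longlongrightarrow> f x) (at_right x)"
  proof (rule order_tendstoI)
    fix c assume "f x < c"
    then obtain b where "x < b" "f b < c"
      using r by blast
    then show "eventually (\<lambda>y. f y < c) (at_right x)"
      unfolding eventually_at_right[OF \<open>x < top\<close>]
      using monoD[OF \<open>mono f\<close>] by (meson le_less_trans less_imp_le)
  next
    fix c assume "c < f x"
    then show "eventually (\<lambda>y. c < f y) (at_right x)"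
      unfolding eventually_at_right[OF \<open>x < top\<close>]
      using monoD[OF \<open>mono f\<close>] \<open>x < top\<close> by (meson less_le_trans less_imp_le)
  qed
  then show ?thesis
    by (simp add: continuous_within)
qed

section \<open>Distance distribution functions\<close>

lemma ddf_iff:
  "f \<in> ddf \<longleftrightarrow> mono f \<and> range f \<subseteq> {0..1} \<and> f 0 = 0 \<and> f top = 1 \<and>
     (\<forall>x>0. x < top \<longrightarrow> (\<forall>c<f x. \<exists>y<x. c < f y))"
  by (auto simp: ddf_def mono_left_continuous_iff)

lemma ddf_bounds: "f \<in> ddf \<Longrightarrow> 0 \<le> f x" "f \<in> ddf \<Longrightarrow> f x \<le> 1"
  by (auto simp: ddf_def image_subset_iff)

lemma ddf_mono: "f \<in> ddf \<Longrightarrow> x \<le> y \<Longrightarrow> f x \<le> f y"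
  by (auto simp: ddf_def mono_def)

lemma nondefective_ddf_iff:
  "f \<in> nondefective_ddf \<longleftrightarrow> f \<in> ddf \<and> (\<forall>c<1. \<exists>x<top. c < f x)"
proof -
  have "(SUP x\<in>{..<top}. f x) = 1 \<longleftrightarrow> (\<forall>c<1. \<exists>x<top. c < f x)" if f: "f \<in> ddf"
  proof -
    have bdd: "bdd_above (f ` {..<top})"
      using ddf_bounds(2)[OF f] by (auto intro!: bdd_aboveI[of _ 1])
    have "0 \<in> {..<top::ennreal}"
      by simp
    then have ne: "{..<top::ennreal} \<noteq> {}"
      by blast
    have le1: "(SUP x\<in>{..<top}. f x) \<le> 1"
      using ne ddf_bounds(2)[OF f] by (intro cSUP_least) auto
    have "(\<forall>c<1. \<exists>x<top. c < f x) \<longleftrightarrow> (\<forall>c<1. c < (SUP x\<in>{..<top}. f x))"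
      using less_cSUP_iff[OF ne bdd] by auto
    also have "\<dots> \<longleftrightarrow> (SUP x\<in>{..<top}. f x) = 1"
      using le1 by (metis less_irrefl order.order_iff_strict)
    finally show ?thesis by simp
  qed
  then show ?thesis
    by (auto simp: nondefective_ddf_def)
qed

lemma nondefective_ddf_subset: "nondefective_ddf \<subseteq> ddf"
  by (auto simp: nondefective_ddf_def)

lemma continuous_ddf_subset: "continuous_ddf \<subseteq> nondefective_ddf"
  by (auto simp: continuous_ddf_def)

text \<open>Left continuity inside and non-defectiveness at \<open>\<infinity>\<close> are already part of the notion,
  so only jumps to the right have to be excluded.\<close>

lemma continuous_ddfI:
  assumes f: "f \<in> nondefective_ddf"
    and r: "\<And>x c. x < top \<Longrightarrow> f x < c \<Longrightarrow> \<exists>y>x. f y < c"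
  shows "f \<in> continuous_ddf"
proof -
  have mono: "mono f"
    using f by (auto simp: nondefective_ddf_def ddf_def)
  have "continuous (at x) f" for x
    unfolding continuous_at_split
  proof
    show "continuous (at_left x) f"
    proof (cases "x = 0")
      case True
      then show ?thesis
        using trivial_limit_at_left_bot[where 'a = ennreal]
        by (simp add: bot_ennreal continuous_within)
    next
      case False
      then have "0 < x" by (simp add: zero_less_iff_neq_zero)
      moreover have "\<forall>c<f x. \<exists>y<x. c < f y"
        using f \<open>0 < x\<close> unfolding nondefective_ddf_iff ddf_iff
        by (cases "x = top") (auto simp: less_top)
      ultimately show ?thesis
        using mono_left_continuous_iff[OF mono] by blast
    qed
    show "continuous (at_right x) f"
    proof (cases "x = top")
      case True
      then show ?thesis
        by (simp add: trivial_limit_at_right_top continuous_within)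
    next
      case False
      then show ?thesis
        using r mono by (intro mono_right_continuousI) (auto simp: less_top)
    qed
  qed
  then show ?thesis
    using f by (simp add: continuous_ddf_def continuous_at_imp_continuous_on)
qed

lemma continuous_ddf_surj:
  assumes g: "g \<in> continuous_ddf" and "0 \<le> p" "p \<le> 1"
  shows "\<exists>t. g t = p"
proof -
  have "g 0 = 0" "g top = 1" "continuous_on {0..top} g"
    using g by (auto simp: continuous_ddf_def nondefective_ddf_def ddf_def
        intro: continuous_on_subset)
  then show ?thesis
    using IVT'[of g 0 p top] assms by auto
qed

subsection \<open>Two families of examples\<close>

lemma step_ddf_nondefective:
  assumes "x < top"
  shows "step_ddf x 1 \<in> nondefective_ddf"
proof -
  have left: "\<exists>y<t. c < step_ddf x 1 y" if "0 < t" "c < step_ddf x 1 t" for t c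
  proof (cases "x < t")
    case True
    then obtain y where "x < y" "y < t" using dense by blast
    then show ?thesis
      using that by (intro exI[of _ y]) (auto simp: step_ddf_def split: if_splits)
  next
    case False
    with that assms have "c < 0" by (auto simp: step_ddf_def split: if_splits)
    with \<open>0 < t\<close> show ?thesis
      by (intro exI[of _ 0]) (auto simp: step_ddf_def)
  qed
  have "\<exists>y<top. c < step_ddf x 1 y" if "c < 1" for c
    using left[of top c] that by (auto simp: step_ddf_def)
  moreover have "mono (step_ddf x 1)"
    using assms by (auto simp: mono_def step_ddf_def less_top top_unique dest: less_le_trans)
  ultimately show ?thesis
    using left by (auto simp: nondefective_ddf_iff ddf_iff step_ddf_def)
qed

text \<open>The linear interpolation from \<open>0\<close> at \<open>a\<close> to \<open>1\<close> at \<open>b\<close>. The argument is cut off at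
  \<open>b\<close> before it is converted to a real number, since the conversion sends \<open>\<infinity>\<close> to \<open>0\<close>.\<close>

definition ramp_ddf :: "real \<Rightarrow> real \<Rightarrow> ennreal \<Rightarrow> real" where
  "ramp_ddf a b x = max 0 ((enn2real (min x (ennreal b)) - a) / (b - a))"

lemma ramp_ddf_below: "0 \<le> a \<Longrightarrow> a < b \<Longrightarrow> x \<le> ennreal a \<Longrightarrow> ramp_ddf a b x = 0"
proof -
  assume *: "0 \<le> a" "a < b" "x \<le> ennreal a"
  then have "enn2real (min x (ennreal b)) \<le> a"
    by (intro enn2real_leI) (auto simp: min.coboundedI1)
  with * show ?thesis by (simp add: ramp_ddf_def divide_nonpos_pos)
qed

lemma ramp_ddf_above: "0 \<le> a \<Longrightarrow> a < b \<Longrightarrow> ennreal b \<le> x \<Longrightarrow> ramp_ddf a b x = 1"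
  by (simp add: ramp_ddf_def min_absorb2)

lemma ramp_ddf_unit: "0 \<le> t \<Longrightarrow> t \<le> 1 \<Longrightarrow> ramp_ddf 0 1 (ennreal t) = t"
proof -
  assume *: "0 \<le> t" "t \<le> 1"
  then have "min (ennreal t) 1 = ennreal t"
    by (simp add: min_absorb1)
  with * show ?thesis by (simp add: ramp_ddf_def)
qed

lemma ramp_ddf_continuous:
  assumes "0 \<le> a" "a < b"
  shows "ramp_ddf a b \<in> continuous_ddf"
proof -
  have min_top: "min x (ennreal b) < top" for x
    by (simp add: min_less_iff_disj)
  have cont: "continuous_on UNIV (ramp_ddf a b)"
  proof -
    have "((\<lambda>y. enn2real (min y (ennreal b))) \<longlongrightarrow> enn2real (min x (ennreal b))) (at x)" for x
    proof (rule tendsto_enn2real)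
      show "((\<lambda>y. min y (ennreal b)) \<longlongrightarrow> ennreal (enn2real (min x (ennreal b)))) (at x)"
        using min_top by (simp, intro tendsto_intros)
    qed simp
    then have "continuous_on UNIV (\<lambda>x. enn2real (min x (ennreal b)))"
      by (simp add: continuous_on_def)
    then show ?thesis
      unfolding ramp_ddf_def using assms by (intro continuous_intros) auto
  qed
  have mono: "mono (ramp_ddf a b)"
  proof (rule monoI)
    fix x y :: ennreal assume "x \<le> y"
    then have "enn2real (min x (ennreal b)) \<le> enn2real (min y (ennreal b))"
      using min_top by (intro enn2real_mono min.mono) auto
    then show "ramp_ddf a b x \<le> ramp_ddf a b y"
      unfolding ramp_ddf_def using assms by (intro max.mono divide_right_mono) auto
  qed
  have bounds: "0 \<le> ramp_ddf a b x" "ramp_ddf a b x \<le> 1" for x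
    using monoD[OF mono, of x top] ramp_ddf_above[OF assms, of top]
    by (auto simp: ramp_ddf_def)
  have above: "ramp_ddf a b x = 1" if "ennreal b \<le> x" for x
    using that assms by (auto intro: ramp_ddf_below ramp_ddf_above)
  have at0: "ramp_ddf a b 0 = 0"
    using assms by (auto intro: ramp_ddf_below)
  have "continuous (at_left x) (ramp_ddf a b)" for x
    using cont by (auto simp: continuous_on_eq_continuous_within intro: continuous_within_subset)
  then have "ramp_ddf a b \<in> ddf"
    using mono bounds at0 above[of top] by (auto simp: ddf_def)
  moreover have "\<exists>x<top. c < ramp_ddf a b x" if "c < 1" for c
    using that above[of "ennreal b"] by (intro exI[of _ "ennreal b"]) auto
  ultimately show ?thesis
    using cont by (auto simp: continuous_ddf_def nondefective_ddf_iff)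
qed

section \<open>Left continuous t-norms\<close>

locale lc_tnorm =
  fixes T :: "real \<Rightarrow> real \<Rightarrow> real"
  assumes left_cont: "left_continuous_t_norm T"
begin

lemma T_norm: "t_norm T"
  using left_cont by (simp add: left_continuous_t_norm_def)

lemma T_bounds: "p \<in> {0..1} \<Longrightarrow> q \<in> {0..1} \<Longrightarrow> T p q \<in> {0..1}"
  and T_commute: "p \<in> {0..1} \<Longrightarrow> q \<in> {0..1} \<Longrightarrow> T p q = T q p"
  and T_one: "p \<in> {0..1} \<Longrightarrow> T 1 p = p" "p \<in> {0..1} \<Longrightarrow> T p 1 = p"
  and T_assoc: "p \<in> {0..1} \<Longrightarrow> q \<in> {0..1} \<Longrightarrow> r \<in> {0..1} \<Longrightarrow> T (T p q) r = T p (T q r)"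
  using T_norm by (auto simp: t_norm_def)

lemma T_mono:
  assumes "p \<le> p'" "q \<le> q'" "p \<in> {0..1}" "p' \<in> {0..1}" "q \<in> {0..1}" "q' \<in> {0..1}"
  shows "T p q \<le> T p' q'"
proof -
  have "T p q \<le> T p q'" "T p q' \<le> T p' q'"
    using T_norm assms unfolding t_norm_def by blast+
  then show ?thesis by simp
qed

lemma T_le_right: "p \<in> {0..1} \<Longrightarrow> q \<in> {0..1} \<Longrightarrow> T p q \<le> q"
  using T_mono[of p 1 q q] T_one(1)[of q] by auto

lemma T_zero: "p \<in> {0..1} \<Longrightarrow> T p 0 = 0" "p \<in> {0..1} \<Longrightarrow> T 0 p = 0"
  using T_le_right[of p 0] T_bounds[of p 0] T_commute[of p 0] by auto

lemma T_less_leftE: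
  assumes "p \<in> {0..1}" "q \<in> {0..1}" "0 \<le> c" "c < T p q"
  obtains p' where "0 \<le> p'" "p' < p" "c < T p' q"
proof -
  have "p \<noteq> 0"
    using assms T_zero(2)[of q] by auto
  then have "0 < p"
    using assms by auto
  have "((\<lambda>(x, y). T x y) \<longlongrightarrow> T p q) (at (p, q) within {0..p} \<times> {0..q})"
    using left_cont assms(1,2) by (auto simp: left_continuous_t_norm_def continuous_within)
  moreover have "filterlim (\<lambda>x. (x, q)) (at (p, q) within {0..p} \<times> {0..q}) (at_left p)"
    unfolding filterlim_at
  proof
    have "eventually (\<lambda>x. x \<in> {0<..<p}) (at_left p)"
      using \<open>0 < p\<close> by (rule eventually_at_left_real)
    then show "eventually (\<lambda>x. (x, q) \<in> {0..p} \<times> {0..q} \<and> (x, q) \<noteq> (p, q)) (at_left p)"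
      by eventually_elim (use assms in auto)
    show "((\<lambda>x. (x, q)) \<longlongrightarrow> (p, q)) (at_left p)"
      by (intro tendsto_intros)
  qed
  ultimately have "((\<lambda>x. T x q) \<longlongrightarrow> T p q) (at_left p)"
    by (auto dest: filterlim_compose)
  then have "eventually (\<lambda>x. c < T x q) (at_left p)"
    using assms by (auto dest: order_tendstoD)
  moreover have "eventually (\<lambda>x. x \<in> {0<..<p}) (at_left p)"
    using \<open>0 < p\<close> by (rule eventually_at_left_real)
  ultimately have "eventually (\<lambda>x. c < T x q \<and> x \<in> {0<..<p}) (at_left p)"
    by (rule eventually_conj)
  then obtain x where "c < T x q" "x \<in> {0<..<p}"
    using eventually_happens'[OF trivial_limit_at_left_real] by blast
  then show ?thesis
    using that[of x] by auto
qed

lemma T_less_rightE: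
  assumes "p \<in> {0..1}" "q \<in> {0..1}" "0 \<le> c" "c < T p q"
  obtains q' where "0 \<le> q'" "q' < q" "c < T p q'"
proof -
  have "c < T q p"
    using assms T_commute[of p q] by simp
  then obtain q' where "0 \<le> q'" "q' < q" "c < T q' p"
    using T_less_leftE assms by blast
  then show ?thesis
    using that[of q'] T_commute[of p q'] assms by auto
qed

lemma T_uniformly_continuous_right:
  assumes "continuous_t_norm T" "0 < e"
  obtains d where "0 < d"
    "\<And>p q q'. p \<in> {0..1} \<Longrightarrow> q \<in> {0..1} \<Longrightarrow> q' \<in> {0..1} \<Longrightarrow> \<bar>q - q'\<bar> < d \<Longrightarrow> \<bar>T p q - T p q'\<bar> < e"
proof -
  have "uniformly_continuous_on ({0..1} \<times> {0..1}) (\<lambda>(x, y). T x y)"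
    using assms(1) by (intro compact_uniformly_continuous compact_Times)
      (auto simp: continuous_t_norm_def)
  then obtain d where "0 < d" and d: "\<And>z z'. z \<in> {0..1} \<times> {0..1} \<Longrightarrow> z' \<in> {0..1} \<times> {0..1} \<Longrightarrow>
      dist z' z < d \<Longrightarrow> dist ((\<lambda>(x, y). T x y) z') ((\<lambda>(x, y). T x y) z) < e"
    using \<open>0 < e\<close> unfolding uniformly_continuous_on_def by metis
  show ?thesis
  proof (rule that[OF \<open>0 < d\<close>])
    fix p q q' :: real
    assume "p \<in> {0..1}" "q \<in> {0..1}" "q' \<in> {0..1}" "\<bar>q - q'\<bar> < d"
    then show "\<bar>T p q - T p q'\<bar> < e"
      using d[of "(p, q')" "(p, q)"] by (simp add: dist_Pair_Pair dist_real_def)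
  qed
qed

text \<open>By monotonicity, \<open>T\<close> stays below a level \<open>c\<close> on the whole rectangle below a point where
  it is below \<open>c\<close>, and dually. Such a point strictly above (below) \<open>(a, b)\<close> is found
  by moving one coordinate at a time, so separate continuity suffices. Clamping the arguments to
  \<open>[0,1]\<close> avoids a case distinction at the boundary of the square.\<close>

lemma continuous_if_sections_continuous:
  assumes sec: "\<And>p. p \<in> {0..1} \<Longrightarrow> continuous_on {0..1} (T p)"
  shows "continuous_t_norm T"
proof -
  define cl :: "real \<Rightarrow> real" where "cl x = max 0 (min 1 x)" for x
  define U where "U x y = T (cl x) (cl y)" for x y
  have cl: "cl x \<in> {0..1}" and cl_mono: "x \<le> y \<Longrightarrow> cl x \<le> cl y"
    and cl_id: "x \<in> {0..1} \<Longrightarrow> cl x = x" for x y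
    by (auto simp: cl_def)
  have U_comm: "U x y = U y x" for x y
    unfolding U_def using cl T_commute by blast
  have U_mono: "x \<le> x' \<Longrightarrow> y \<le> y' \<Longrightarrow> U x y \<le> U x' y'" for x x' y y'
    unfolding U_def using cl cl_mono T_mono by presburger
  have "continuous_on UNIV (U x)" for x
    unfolding U_def
  proof (rule continuous_on_compose2[OF sec[OF cl]])
    show "continuous_on UNIV cl"
      unfolding cl_def by (intro continuous_intros)
  qed (use cl in auto)
  then have lim: "(U x \<longlongrightarrow> U x y) (at y within S)" for x y S
    by (meson UNIV_I continuous_on_def subset_UNIV tendsto_within_subset)
  have up: "\<exists>z>y. U x z < c" if "U x y < c" for x y c
  proof -
    have "eventually (\<lambda>z. U x z < c) (at_right y)"
      using order_tendstoD(2)[OF lim that] .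
    with eventually_at_right_less[of y] have "eventually (\<lambda>z. y < z \<and> U x z < c) (at_right y)"
      by (rule eventually_conj)
    then show ?thesis
      using eventually_happens'[OF trivial_limit_at_right_real] by blast
  qed
  have down: "\<exists>z<y. c < U x z" if "c < U x y" for x y c
  proof -
    have "eventually (\<lambda>z. c < U x z) (at_left y)"
      using order_tendstoD(1)[OF lim that] .
    moreover have "eventually (\<lambda>z. z \<in> {y - 1<..<y}) (at_left y)"
      by (rule eventually_at_left_real) simp
    ultimately have "eventually (\<lambda>z. c < U x z \<and> z \<in> {y - 1<..<y}) (at_left y)"
      by (rule eventually_conj)
    then show ?thesis
      using eventually_happens'[OF trivial_limit_at_left_real] by fastforce
  qed
  have "((\<lambda>z. U (fst z) (snd z)) \<longlongrightarrow> U a b) (at (a, b))" for a b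
  proof (rule order_tendstoI)
    fix c assume "U a b < c"
    then obtain b' where "b < b'" "U a b' < c" using up by blast
    then obtain a' where "a < a'" "U a' b' < c" using up[of b' a c] U_comm by metis
    have "(a, b) \<in> {..<a'} \<times> {..<b'}"
      using \<open>a < a'\<close> \<open>b < b'\<close> by simp
    then have "eventually (\<lambda>z. z \<in> {..<a'} \<times> {..<b'}) (at (a, b))"
      by (intro eventually_at_in_open') (auto intro: open_Times)
    then show "eventually (\<lambda>z. U (fst z) (snd z) < c) (at (a, b))"
    proof eventually_elim
      case (elim z)
      then have "U (fst z) (snd z) \<le> U a' b'"
        by (intro U_mono) auto
      with \<open>U a' b' < c\<close> show ?case by simp
    qed
  next
    fix c assume "c < U a b"
    then obtain b' where "b' < b" "c < U a b'" using down by blast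
    then obtain a' where "a' < a" "c < U a' b'" using down[of c b' a] U_comm by metis
    have "(a, b) \<in> {a'<..} \<times> {b'<..}"
      using \<open>a' < a\<close> \<open>b' < b\<close> by simp
    then have "eventually (\<lambda>z. z \<in> {a'<..} \<times> {b'<..}) (at (a, b))"
      by (intro eventually_at_in_open') (auto intro: open_Times)
    then show "eventually (\<lambda>z. c < U (fst z) (snd z)) (at (a, b))"
    proof eventually_elim
      case (elim z)
      then have "U a' b' \<le> U (fst z) (snd z)"
        by (intro U_mono) auto
      with \<open>c < U a' b'\<close> show ?case by simp
    qed
  qed
  then have "continuous_on UNIV (\<lambda>z. U (fst z) (snd z))"
    by (simp add: continuous_on_def)
  then have "continuous_on ({0..1} \<times> {0..1}) (\<lambda>z. U (fst z) (snd z))"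
    by (rule continuous_on_subset) simp
  then have "continuous_on ({0..1} \<times> {0..1}) (\<lambda>(x, y). T x y)"
    by (rule continuous_on_cong[THEN iffD1, rotated -1]) (auto simp: U_def cl_id)
  then show ?thesis
    using T_norm by (simp add: continuous_t_norm_def)
qed

end

section \<open>Right continuous t-conorms\<close>

locale rc_tconorm =
  fixes L :: "ennreal \<Rightarrow> ennreal \<Rightarrow> ennreal"
  assumes right_cont: "right_continuous_t_conorm L"
begin

lemma L_conorm: "t_conorm L"
  using right_cont by (simp add: right_continuous_t_conorm_def)

lemma L_commute: "L r s = L s r"
  and L_assoc: "L (L r s) t = L r (L s t)"
  and L_zero: "L 0 r = r" "L r 0 = r"
  using L_conorm by (auto simp: t_conorm_def)

lemma L_mono: "r \<le> r' \<Longrightarrow> s \<le> s' \<Longrightarrow> L r s \<le> L r' s'"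
  using L_conorm unfolding t_conorm_def by (meson order_trans)

lemma L_ge: "r \<le> L r s" "s \<le> L r s"
  using L_mono[of r r 0 s] L_mono[of 0 r s s] L_zero by auto

lemma L_top: "L top s = top"
  using L_ge(1)[of top s] by (simp add: top_unique)

lemma L_less_rightE:
  assumes "L r s < x"
  obtains r' where "r < r'" "L r' s < x"
proof -
  have "r < top"
    using L_ge(1)[of r s] assms by (metis le_less_trans less_le_trans top_greatest)
  have "((\<lambda>(x, y). L x y) \<longlongrightarrow> L r s) (at (r, s) within {r..} \<times> {s..})"
    using right_cont by (auto simp: right_continuous_t_conorm_def continuous_within)
  moreover have "filterlim (\<lambda>r'. (r', s)) (at (r, s) within {r..} \<times> {s..}) (at_right r)"
    unfolding filterlim_at
    by (auto intro!: tendsto_intros always_eventually simp: eventually_at_filter)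
  ultimately have "((\<lambda>r'. L r' s) \<longlongrightarrow> L r s) (at_right r)"
    by (auto dest: filterlim_compose)
  then have "eventually (\<lambda>r'. L r' s < x) (at_right r)"
    using assms by (auto dest: order_tendstoD)
  then obtain b where "r < b" "\<And>r'. r < r' \<Longrightarrow> r' < b \<Longrightarrow> L r' s < x"
    unfolding eventually_at_right[OF \<open>r < top\<close>] by blast
  then show ?thesis
    using that dense by blast
qed

text \<open>Let \<open>r\<^sub>0\<close> be the least \<open>r\<close> with \<open>x \<le> L r a\<close>; right continuity makes the infimum attained.
  If \<open>r\<^sub>0\<close> is finite, then \<open>L r\<^sub>0 b\<close> is strictly larger than \<open>L r\<^sub>0 a\<close> by cancellation,
  hence than \<open>x\<close>; otherwise it is \<open>\<infinity>\<close>. In both cases it serves as \<open>y\<close>: below it only arguments \<open>r < r\<^sub>0\<close> occur. The point is that \<open>y\<close>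
  does not depend on \<open>r\<close>.\<close>

lemma cancellation_uniform_gap:
  assumes "cancellation_law L" "a < b" "x < top"
  shows "\<exists>y>x. \<forall>r. L r b < y \<longrightarrow> L r a < x"
proof -
  define r0 where "r0 = Inf {r. x \<le> L r a}"
  have ge: "x \<le> L r0 a"
  proof (rule ccontr)
    assume "\<not> x \<le> L r0 a"
    then obtain r' where "r0 < r'" "L r' a < x"
      using L_less_rightE by (metis not_le)
    then obtain r where "x \<le> L r a" "r < r'"
      unfolding r0_def Inf_less_iff by blast
    then have "x \<le> L r' a"
      using L_mono[of r r' a a] by (metis less_imp_le order_refl order_trans)
    with \<open>L r' a < x\<close> show False by simp
  qed
  have "x < L r0 b"
  proof (cases "r0 = top")
    case True
    then show ?thesis using \<open>x < top\<close> by (simp add: L_top)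
  next
    case False
    then have "L r0 a \<noteq> L r0 b"
      using assms(1,2) unfolding cancellation_law_def by blast
    moreover have "L r0 a \<le> L r0 b"
      using L_mono[of r0 r0 a b] \<open>a < b\<close> by auto
    ultimately show ?thesis using ge by simp
  qed
  moreover have "L r a < x" if "L r b < L r0 b" for r
  proof (rule ccontr)
    assume "\<not> L r a < x"
    then have "r0 \<le> r"
      unfolding r0_def by (intro Inf_lower) auto
    then show False
      using L_mono[of r0 r b b] that by auto
  qed
  ultimately show ?thesis by blast
qed

lemma cancellation_finite:
  assumes "cancellation_law L" "r < top" "s < top"
  shows "L r s < top"
proof -
  have "L r s \<noteq> L r top"
    using assms unfolding cancellation_law_def by blast
  then show ?thesis
    using L_commute[of r top] by (simp add: L_top less_top)
qed

end

section \<open>The operation on distance distribution functions\<close>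

locale tensor_product = lc_tnorm T + rc_tconorm L
  for T :: "real \<Rightarrow> real \<Rightarrow> real" and L :: "ennreal \<Rightarrow> ennreal \<Rightarrow> ennreal"
begin

abbreviation tensor :: "(ennreal \<Rightarrow> real) \<Rightarrow> (ennreal \<Rightarrow> real) \<Rightarrow> ennreal \<Rightarrow> real"
  where "tensor \<equiv> tensor_op L T"

lemma T_ddf_bounds: "f \<in> ddf \<Longrightarrow> g \<in> ddf \<Longrightarrow> T (f r) (g s) \<in> {0..1}"
  by (intro T_bounds) (auto simp: ddf_bounds)

lemma step_bounds:
  "f \<in> ddf \<Longrightarrow> g \<in> ddf \<Longrightarrow> step_ddf (L r s) (T (f r) (g s)) x \<in> {0..1}"
  using T_ddf_bounds by (simp add: step_ddf_def)

lemma tensor_bdd: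
  assumes "f \<in> ddf" "g \<in> ddf"
  shows "bdd_above ((\<lambda>(r, s). step_ddf (L r s) (T (f r) (g s)) x) ` UNIV)"
  using step_bounds[OF assms] by (auto intro!: bdd_aboveI[of _ 1])

text \<open>Everything about the operation is read off from its strict upper level sets. The
  restriction to \<open>c \<ge> 0\<close> is due to the pairs with \<open>L r s \<ge> x\<close>, which contribute \<open>0\<close> to the
  supremum.\<close>

lemma less_tensor_iff:
  assumes "f \<in> ddf" "g \<in> ddf" "x < top" "0 \<le> c"
  shows "c < tensor f g x \<longleftrightarrow> (\<exists>r s. L r s < x \<and> c < T (f r) (g s))"
proof -
  have "c < tensor f g x \<longleftrightarrow> (\<exists>r s. c < step_ddf (L r s) (T (f r) (g s)) x)"
    unfolding tensor_op_def
    by (subst less_cSUP_iff[OF _ tensor_bdd]) (use assms in auto)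
  then show ?thesis
    using assms by (auto simp: step_ddf_def split: if_splits)
qed

lemma tensor_top: "tensor f g top = 1"
  by (simp add: tensor_op_def step_ddf_def case_prod_unfold)

lemma tensor_bounds:
  assumes "f \<in> ddf" "g \<in> ddf"
  shows "0 \<le> tensor f g x" "tensor f g x \<le> 1"
proof -
  have "(case (0, 0) of (r, s) \<Rightarrow> step_ddf (L r s) (T (f r) (g s)) x) \<le> tensor f g x"
    unfolding tensor_op_def by (rule cSUP_upper[OF UNIV_I tensor_bdd[OF assms]])
  then show "0 \<le> tensor f g x"
    using step_bounds[OF assms, of 0 0 x] by simp
  show "tensor f g x \<le> 1"
    unfolding tensor_op_def using step_bounds[OF assms] by (intro cSUP_least) auto
qed

lemma tensor_upper:
  assumes "f \<in> ddf" "g \<in> ddf" "x < top" "L r s < x"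
  shows "T (f r) (g s) \<le> tensor f g x"
proof (rule ccontr)
  assume "\<not> T (f r) (g s) \<le> tensor f g x"
  then have "tensor f g x < tensor f g x"
    using assms less_tensor_iff[OF assms(1-3) tensor_bounds(1)[OF assms(1,2)]]
    by (meson not_le)
  then show False by simp
qed

lemma tensor_least:
  assumes "f \<in> ddf" "g \<in> ddf" "x < top" "0 \<le> c"
    and "\<And>r s. L r s < x \<Longrightarrow> T (f r) (g s) \<le> c"
  shows "tensor f g x \<le> c"
  using less_tensor_iff[OF assms(1-4)] assms(5) by (meson not_le)

lemma tensor_ddf:
  assumes f: "f \<in> ddf" and g: "g \<in> ddf"
  shows "tensor f g \<in> ddf"
proof -
  have "mono (tensor f g)"
  proof (rule monoI)
    fix x y :: ennreal assume "x \<le> y"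
    show "tensor f g x \<le> tensor f g y"
    proof (cases "y = top")
      case True
      then show ?thesis using tensor_bounds(2)[OF f g] by (simp add: tensor_top)
    next
      case False
      then have "y < top" by (simp add: less_top)
      then show ?thesis
        using \<open>x \<le> y\<close> tensor_bounds[OF f g]
        by (intro tensor_least f g tensor_upper[OF f g]) auto
    qed
  qed
  moreover have "tensor f g 0 = 0"
    using tensor_least[OF f g, of 0 0] tensor_bounds(1)[OF f g, of 0] by auto
  moreover have "\<exists>y<x. c < tensor f g y" if "0 < x" "x < top" "c < tensor f g x" for x c
  proof (cases "c < 0")
    case True
    then show ?thesis
      using \<open>0 < x\<close> tensor_bounds(1)[OF f g, of 0] by (intro exI[of _ 0]) auto
  next
    case False
    then obtain r s where "L r s < x" "c < T (f r) (g s)"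
      using \<open>c < tensor f g x\<close> less_tensor_iff[OF f g \<open>x < top\<close>, of c] by (meson not_le)
    moreover then obtain y where "L r s < y" "y < x"
      using dense by blast
    ultimately show ?thesis
      using tensor_upper[OF f g, of y r s] less_trans[OF \<open>y < x\<close> \<open>x < top\<close>]
      by (intro exI[of _ y]) auto
  qed
  ultimately show ?thesis
    using tensor_bounds[OF f g] by (auto simp: ddf_iff tensor_top)
qed

lemma tensor_commute:
  assumes f: "f \<in> ddf" and g: "g \<in> ddf"
  shows "tensor f g = tensor g f"
proof -
  have "T (f r) (g s) = T (g s) (f r)" for r s
    using ddf_bounds f g by (intro T_commute) auto
  then have "tensor f g x \<le> tensor g f x \<and> tensor g f x \<le> tensor f g x" for x
  proof (cases "x = top")
    case False
    then have "x < top" by (simp add: less_top)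
    then show ?thesis
      using tensor_upper[OF f g \<open>x < top\<close>] tensor_upper[OF g f \<open>x < top\<close>]
        tensor_bounds(1)[OF f g] tensor_bounds(1)[OF g f] L_commute
        \<open>\<And>r s. T (f r) (g s) = T (g s) (f r)\<close>
      by (auto intro!: tensor_least f g)
  qed (simp add: tensor_top)
  then show ?thesis
    by (intro ext antisym) auto
qed

text \<open>The inner supremum is resolved by left continuity of \<open>T\<close>, and room for an argument
  strictly above \<open>L r s\<close> is provided by right continuity of \<open>L\<close>.\<close>

lemma less_tensor_tensor_iff:
  assumes f: "f \<in> ddf" and g: "g \<in> ddf" and h: "h \<in> ddf" and "x < top" "0 \<le> c"
  shows "c < tensor (tensor f g) h x \<longleftrightarrow>
    (\<exists>r s t. L (L r s) t < x \<and> c < T (T (f r) (g s)) (h t))"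
proof -
  have fg: "tensor f g \<in> ddf"
    using tensor_ddf[OF f g] .
  have "(\<exists>u t. L u t < x \<and> c < T (tensor f g u) (h t)) \<longleftrightarrow>
    (\<exists>r s t. L (L r s) t < x \<and> c < T (T (f r) (g s)) (h t))"
  proof
    assume "\<exists>u t. L u t < x \<and> c < T (tensor f g u) (h t)"
    then obtain u t where ut: "L u t < x" "c < T (tensor f g u) (h t)"
      by blast
    then obtain p where p: "0 \<le> p" "p < tensor f g u" "c < T p (h t)"
      using T_less_leftE ddf_bounds[OF fg] ddf_bounds[OF h] \<open>0 \<le> c\<close>
      by (metis atLeastAtMost_iff)
    have "u < top"
      using L_ge(1)[of u t] ut(1) \<open>x < top\<close> by auto
    then obtain r s where rs: "L r s < u" "p < T (f r) (g s)"
      using less_tensor_iff[OF f g] p by blast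
    have "L (L r s) t \<le> L u t"
      using rs by (intro L_mono) auto
    moreover have "T p (h t) \<le> T (T (f r) (g s)) (h t)"
      using rs p ddf_bounds[OF h] T_ddf_bounds[OF f g, of r s] by (intro T_mono) auto
    ultimately show "\<exists>r s t. L (L r s) t < x \<and> c < T (T (f r) (g s)) (h t)"
      using ut p by (meson le_less_trans less_le_trans)
  next
    assume "\<exists>r s t. L (L r s) t < x \<and> c < T (T (f r) (g s)) (h t)"
    then obtain r s t where rst: "L (L r s) t < x" "c < T (T (f r) (g s)) (h t)"
      by blast
    then obtain u where u: "L r s < u" "L u t < x"
      using L_less_rightE by blast
    have "u < top"
      using L_ge(1)[of u t] u(2) \<open>x < top\<close> by auto
    then have "T (T (f r) (g s)) (h t) \<le> T (tensor f g u) (h t)"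
      using tensor_upper[OF f g _ u(1)] tensor_bounds[OF f g, of u] ddf_bounds[OF h]
        T_ddf_bounds[OF f g, of r s]
      by (intro T_mono) auto
    then show "\<exists>u t. L u t < x \<and> c < T (tensor f g u) (h t)"
      using u rst by (meson less_le_trans)
  qed
  then show ?thesis
    using less_tensor_iff[OF fg h \<open>x < top\<close> \<open>0 \<le> c\<close>] by simp
qed

text \<open>By commutativity it suffices to compare the cyclic permutations \<open>(f g) h\<close> and
  \<open>(g h) f\<close>, whose level sets both have the previous form.\<close>

lemma tensor_assoc:
  assumes f: "f \<in> ddf" and g: "g \<in> ddf" and h: "h \<in> ddf"
  shows "tensor (tensor f g) h = tensor f (tensor g h)"
proof -
  have rotate_T: "T (T (f r) (g s)) (h t) = T (T (g s) (h t)) (f r)" for r s t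
  proof -
    have "T (T (f r) (g s)) (h t) = T (f r) (T (g s) (h t))"
      using ddf_bounds f g h by (intro T_assoc) auto
    also have "\<dots> = T (T (g s) (h t)) (f r)"
      using ddf_bounds[OF f] by (intro T_commute T_ddf_bounds[OF g h]) auto
    finally show ?thesis .
  qed
  have rotate_L: "L (L r s) t = L (L s t) r" for r s t
    using L_assoc[of r s t] L_commute[of r "L s t"] by simp
  have level: "c < tensor (tensor f g) h x \<longleftrightarrow> c < tensor (tensor g h) f x"
    if "x < top" "0 \<le> c" for c x
  proof -
    have "L (L r s) t < x \<and> c < T (T (f r) (g s)) (h t) \<longleftrightarrow>
        L (L s t) r < x \<and> c < T (T (g s) (h t)) (f r)" for r s t
      using rotate_L[of r s t] rotate_T[of r s t] by simp
    then show ?thesis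
      unfolding less_tensor_tensor_iff[OF f g h that] less_tensor_tensor_iff[OF g h f that]
      by blast
  qed
  have "tensor (tensor f g) h x = tensor (tensor g h) f x" for x
  proof (cases "x = top")
    case False
    then have "x < top" by (simp add: less_top)
    then show ?thesis
      using level[of x] tensor_bounds(1)[OF tensor_ddf[OF f g] h, of x]
        tensor_bounds(1)[OF tensor_ddf[OF g h] f, of x]
      by (metis less_irrefl linorder_neqE_linordered_idom)
  qed (simp add: tensor_top)
  then show ?thesis
    using tensor_commute[OF f tensor_ddf[OF g h]] by auto
qed

section \<open>Sufficiency\<close>

lemma tensor_nondefective:
  assumes L: "cancellation_law L" and f: "f \<in> nondefective_ddf" and g: "g \<in> nondefective_ddf"
  shows "tensor f g \<in> nondefective_ddf"
proof -
  have fd: "f \<in> ddf" and gd: "g \<in> ddf"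
    using f g nondefective_ddf_subset by auto
  have "\<exists>x<top. c < tensor f g x" if "c < 1" for c
  proof -
    have "max 0 c < T 1 1" "0 \<le> max 0 c"
      using that T_one[of 1] by auto
    then obtain p where p: "0 \<le> p" "p < 1" "max 0 c < T p 1"
      using T_less_leftE[of 1 1 "max 0 c"] by auto
    then obtain q where q: "0 \<le> q" "q < 1" "max 0 c < T p q"
      using T_less_rightE[of p 1 "max 0 c"] by auto
    obtain r where r: "r < top" "p < f r"
      using f p unfolding nondefective_ddf_iff by blast
    obtain s where s: "s < top" "q < g s"
      using g q unfolding nondefective_ddf_iff by blast
    have "T p q \<le> T (f r) (g s)"
      using p q r s ddf_bounds[OF fd, of r] ddf_bounds[OF gd, of s] by (intro T_mono) auto
    moreover obtain x where "L r s < x" "x < top"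
      using cancellation_finite[OF L r(1) s(1)] dense by blast
    ultimately show ?thesis
      using q tensor_upper[OF fd gd, of x r s] by (intro exI[of _ x]) auto
  qed
  then show ?thesis
    using tensor_ddf[OF fd gd] by (simp add: nondefective_ddf_iff)
qed

text \<open>Continuity of \<open>g\<close> provides points \<open>t\<^sub>0 < t\<^sub>1 < \<dots>\<close> at which \<open>g\<close> takes the values
  \<open>i / n\<close>. Replacing \<open>s\<close> by a grid point one full cell to its left changes \<open>T (f r) (g s)\<close>
  only a little, but lowers \<open>L r s\<close> from below \<open>y\<close> to below \<open>x\<close>, for one \<open>y > x\<close> that works
  for all \<open>r\<close> and, the grid being finite, for all cells. In the first cell there is no room to
  the left, but there \<open>T (f r) (g s) \<le> g s\<close> is small itself.\<close>

lemma tensor_no_right_jump: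
  assumes T: "continuous_t_norm T" and L: "cancellation_law L"
    and f: "f \<in> ddf" and g: "g \<in> continuous_ddf" and "x < top" "tensor f g x < c"
  shows "\<exists>y>x. tensor f g y < c"
proof -
  have gd: "g \<in> ddf"
    using g continuous_ddf_subset nondefective_ddf_subset by auto
  define e where "e = (c - tensor f g x) / 2"
  have "0 < e"
    using assms by (simp add: e_def)
  obtain d where "0 < d" and d: "\<And>p q q'. p \<in> {0..1} \<Longrightarrow> q \<in> {0..1} \<Longrightarrow> q' \<in> {0..1} \<Longrightarrow>
      \<bar>q - q'\<bar> < d \<Longrightarrow> \<bar>T p q - T p q'\<bar> < e"
    using T_uniformly_continuous_right[OF T \<open>0 < e\<close>] by blast
  \<comment> \<open>Two cells of length \<open>1 / n\<close> have to fit into the tolerance \<open>d\<close>.\<close>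
  obtain n :: nat where n: "2 / min d e < real n"
    using reals_Archimedean2 by blast
  have "0 < 2 / min d e"
    using \<open>0 < d\<close> \<open>0 < e\<close> by simp
  then have "0 < real n"
    using n by linarith
  have "0 < min d e"
    using \<open>0 < d\<close> \<open>0 < e\<close> by simp
  then have "2 / real n < min d e"
    using n \<open>0 < real n\<close> by (metis mult.commute pos_divide_less_eq)
  then have mesh: "2 / real n < d" "2 / real n < e"
    by (simp_all only: min_less_iff_conj)
  have "\<exists>t. g t = real i / real n" if "i < n" for i
    using that by (intro continuous_ddf_surj[OF g]) auto
  then obtain t where t: "\<And>i. i < n \<Longrightarrow> g (t i) = real i / real n"
    by metis
  have t_less: "t i < s" if "i < n" "real i / real n < g s" for i s
  proof (rule ccontr)
    assume "\<not> t i < s"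
    then show False
      using that t[of i] ddf_mono[OF gd, of s "t i"] by (simp add: not_less)
  qed
  have "\<forall>i. \<exists>y>x. Suc i < n \<longrightarrow> (\<forall>r. L r (t (Suc i)) < y \<longrightarrow> L r (t i) < x)"
  proof
    fix i
    show "\<exists>y>x. Suc i < n \<longrightarrow> (\<forall>r. L r (t (Suc i)) < y \<longrightarrow> L r (t i) < x)"
    proof (cases "Suc i < n")
      case True
      then have "t i < t (Suc i)"
        using t[of "Suc i"] \<open>0 < real n\<close> by (intro t_less) (auto simp: divide_strict_right_mono)
      then show ?thesis
        using cancellation_uniform_gap[OF L _ \<open>x < top\<close>] by blast
    qed (use \<open>x < top\<close> in blast)
  qed
  then obtain Y where Y_gt: "\<And>i. x < Y i"
    and Y: "\<And>i r. Suc i < n \<Longrightarrow> L r (t (Suc i)) < Y i \<Longrightarrow> L r (t i) < x"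
    by metis
  have "x < Min (insert top (Y ` {..<n}))"
    using Y_gt \<open>x < top\<close> by simp
  then obtain y where y: "x < y" "y < Min (insert top (Y ` {..<n}))"
    using dense by blast
  then have "y < top" and y_less: "\<And>i. i < n \<Longrightarrow> y < Y i"
    by auto
  have "tensor f g y \<le> tensor f g x + e"
  proof (rule tensor_least[OF f gd \<open>y < top\<close>])
    show "0 \<le> tensor f g x + e"
      using tensor_bounds(1)[OF f gd, of x] \<open>0 < e\<close> by simp
    fix r s assume rs: "L r s < y"
    have fr: "f r \<in> {0..1}" and gs: "g s \<in> {0..1}"
      using ddf_bounds f gd by auto
    \<comment> \<open>\<open>g s\<close> lies in the \<open>k\<close>-th cell \<open>((k - 1) / n, k / n]\<close>; so \<open>t (k - 1) < s\<close>, and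
      \<open>t (k - 2)\<close> replaces \<open>s\<close>.\<close>
    define k where "k = nat \<lceil>real n * g s\<rceil>"
    have "0 \<le> real n * g s"
      using gs \<open>0 < real n\<close> by simp
    then have k: "real k - 1 < real n * g s" "real n * g s \<le> real k"
      unfolding k_def by linarith+
    have "real n * g s \<le> real n"
      using gs \<open>0 < real n\<close> by simp
    then have "k \<le> n"
      using k(1) by linarith
    show "T (f r) (g s) \<le> tensor f g x + e"
    proof (cases "k \<le> 1")
      case True
      then have "real n * g s \<le> 1"
        using k(2) by linarith
      then have "g s \<le> 1 / real n"
        using \<open>0 < real n\<close> by (simp add: field_simps)
      also have "\<dots> \<le> e"
        using mesh(2) \<open>0 < real n\<close> by (simp add: field_simps)
      finally show ?thesis
        using T_le_right[OF fr gs] tensor_bounds(1)[OF f gd, of x] by simp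
    next
      case False
      then obtain i where i: "k = Suc (Suc i)"
        by (metis One_nat_def Suc_le_mono le0 not0_implies_Suc)
      then have "Suc i < n"
        using \<open>k \<le> n\<close> by simp
      have "t (Suc i) < s"
        using k(1) i \<open>0 < real n\<close> by (intro t_less[OF \<open>Suc i < n\<close>]) (simp add: field_simps)
      then have "L r (t (Suc i)) \<le> L r s"
        by (intro L_mono) auto
      then have "L r (t i) < x"
        using rs y_less[of i] \<open>Suc i < n\<close> by (intro Y[OF \<open>Suc i < n\<close>]) auto
      then have "T (f r) (g (t i)) \<le> tensor f g x"
        by (rule tensor_upper[OF f gd \<open>x < top\<close>])
      moreover have "\<bar>T (f r) (g s) - T (f r) (g (t i))\<bar> < e"
      proof (rule d[OF fr gs])
        show "g (t i) \<in> {0..1}"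
          using ddf_bounds gd by auto
        have "g s \<le> (real i + 2) / real n" "real i / real n \<le> g s"
          using k i \<open>0 < real n\<close> by (simp_all add: field_simps)
        then show "\<bar>g s - g (t i)\<bar> < d"
          using mesh(1) t[of i] \<open>Suc i < n\<close> by (simp add: add_divide_distrib)
      qed
      ultimately show ?thesis by linarith
    qed
  qed
  also have "\<dots> < c"
    using \<open>tensor f g x < c\<close> by (simp add: e_def field_simps)
  finally show ?thesis
    using \<open>x < y\<close> by blast
qed

lemma tensor_continuous:
  assumes "continuous_t_norm T" "cancellation_law L" "f \<in> nondefective_ddf" "g \<in> continuous_ddf"
  shows "tensor f g \<in> continuous_ddf"
proof (rule continuous_ddfI)
  show "tensor f g \<in> nondefective_ddf"
    using assms continuous_ddf_subset by (intro tensor_nondefective) auto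
qed (use assms nondefective_ddf_subset in \<open>auto intro: tensor_no_right_jump\<close>)

lemma continuous_ddf_ideal:
  assumes "continuous_t_norm T" "cancellation_law L"
  shows "semigroup_ideal continuous_ddf nondefective_ddf tensor"
proof -
  have "ramp_ddf 0 1 \<in> continuous_ddf"
    by (rule ramp_ddf_continuous) auto
  moreover have "comm_semigroup_on nondefective_ddf tensor"
    unfolding comm_semigroup_on_def
  proof (intro conjI ballI)
    fix f g h
    assume *: "f \<in> nondefective_ddf" "g \<in> nondefective_ddf"
    then show "tensor f g \<in> nondefective_ddf"
      by (rule tensor_nondefective[OF assms(2)])
    have ddf: "f \<in> ddf" "g \<in> ddf"
      using * nondefective_ddf_subset by auto
    then show "tensor f g = tensor g f"
      by (rule tensor_commute)
    assume "h \<in> nondefective_ddf"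
    then have "h \<in> ddf"
      using nondefective_ddf_subset by auto
    with ddf show "tensor (tensor f g) h = tensor f (tensor g h)"
      by (rule tensor_assoc)
  qed
  ultimately show ?thesis
    unfolding semigroup_ideal_def
    using tensor_continuous[OF assms] continuous_ddf_subset by blast
qed

section \<open>Necessity\<close>

text \<open>Suppose \<open>L x y = L x z\<close> with \<open>x < \<infinity>\<close> and \<open>y < z\<close>, and let \<open>g\<close> be \<open>0\<close> up to
  \<open>y\<close> and \<open>1\<close> from \<open>z\<close> on. If the product \<open>h\<close> of \<open>\<epsilon>(x,1)\<close> and \<open>g\<close> is positive at
  \<open>t\<close>, this is due to some \<open>r > x\<close> and \<open>s > y\<close>, so \<open>L x y < t\<close>. Then \<open>L x z < t\<close>,
  and right continuity leaves room for an argument above \<open>x\<close>, so that already \<open>h t = 1\<close>.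
  A continuous \<open>h\<close> would take the value \<open>1/2\<close>.\<close>

lemma cancellation_if_tensor_continuous:
  assumes cont: "\<And>f g. f \<in> nondefective_ddf \<Longrightarrow> g \<in> continuous_ddf \<Longrightarrow> tensor f g \<in> continuous_ddf"
  shows "cancellation_law L"
proof -
  have False if eq: "L x y = L x z" and "x < top" "y < z" for x y z
  proof -
    obtain z' where z': "y < z'" "z' < z"
      using \<open>y < z\<close> dense by blast
    then have fin: "y < top" "z' < top"
      by (auto intro: less_le_trans[OF _ top_greatest])
    define g where "g = ramp_ddf (enn2real y) (enn2real z')"
    define h where "h = tensor (step_ddf x 1) g"
    have ab: "0 \<le> enn2real y" "enn2real y < enn2real z'"
      using z' fin by (auto simp: enn2real_less_iff)
    have g: "g \<in> continuous_ddf" "g y = 0" "g z = 1"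
      using ramp_ddf_continuous[OF ab] ramp_ddf_below[OF ab, of y] ramp_ddf_above[OF ab, of z]
        fin z' by (auto simp: g_def)
    have f: "step_ddf x 1 \<in> nondefective_ddf"
      using step_ddf_nondefective[OF \<open>x < top\<close>] .
    have fd: "step_ddf x 1 \<in> ddf" and gd: "g \<in> ddf"
      using f g continuous_ddf_subset nondefective_ddf_subset by auto
    have "h \<in> continuous_ddf"
      unfolding h_def using cont[OF f g(1)] .
    then obtain t where t: "h t = 1 / 2"
      using continuous_ddf_surj[of h "1 / 2"] by auto
    have "t \<noteq> top"
      using t by (auto simp: h_def tensor_top)
    then have "t < top"
      by (simp add: less_top)
    have "0 < h t"
      using t by simp
    then obtain r s where rs: "L r s < t" "0 < T (step_ddf x 1 r) (g s)"
      unfolding h_def using less_tensor_iff[OF fd gd \<open>t < top\<close>, of 0] by auto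
    have "step_ddf x 1 r \<noteq> 0" "g s \<noteq> 0"
      using rs(2) T_zero ddf_bounds fd gd by fastforce+
    then have "x < r"
      using \<open>x < top\<close> by (auto simp: step_ddf_def split: if_splits)
    moreover have "y < s"
    proof (rule ccontr)
      assume "\<not> y < s"
      then have "g s \<le> 0"
        using ddf_mono[OF gd, of s y] g(2) by simp
      then show False
        using \<open>g s \<noteq> 0\<close> ddf_bounds(1)[OF gd, of s] by simp
    qed
    ultimately have "L x y \<le> L r s"
      by (intro L_mono) auto
    then have "L x z < t"
      using rs eq by simp
    then obtain r' where r': "x < r'" "L r' z < t"
      using L_less_rightE by blast
    have "T (step_ddf x 1 r') (g z) = 1"
      using r' g(3) T_one[of 1] by (simp add: step_ddf_def)
    then have "1 \<le> h t"
      using tensor_upper[OF fd gd \<open>t < top\<close> r'(2)] by (simp add: h_def)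
    then show False
      using t by simp
  qed
  then show ?thesis
    unfolding cancellation_law_def by (metis less_top linorder_neqE)
qed

text \<open>For \<open>x \<le> 1\<close> the pairs with \<open>L r s < x\<close> satisfy \<open>r, s < x \<le> 1\<close>, where \<open>f\<close> is at most
  \<open>p\<close> and \<open>g\<close> is the identity, so the product is at most \<open>T p x\<close>. It is not
  smaller: \<open>L 0 s = s\<close>, so for \<open>s < x\<close> right continuity gives some \<open>r > 0\<close> with \<open>L r s < x\<close>,
  and the values \<open>T p s\<close> approach \<open>T p x\<close> by left continuity of \<open>T\<close>.\<close>

lemma T_continuous_if_tensor_continuous:
  assumes cont: "\<And>f g. f \<in> nondefective_ddf \<Longrightarrow> g \<in> continuous_ddf \<Longrightarrow> tensor f g \<in> continuous_ddf"
  shows "continuous_t_norm T"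
proof (rule continuous_if_sections_continuous)
  fix p :: real assume p: "p \<in> {0..1}"
  define f :: "ennreal \<Rightarrow> real"
    where "f r = (if r = 0 then 0 else if r \<le> 1 then p else 1)" for r
  define g where "g = ramp_ddf 0 1"
  have g: "g \<in> continuous_ddf"
    unfolding g_def by (rule ramp_ddf_continuous) auto
  have f: "f \<in> nondefective_ddf"
    unfolding nondefective_ddf_iff ddf_iff
  proof (intro conjI allI impI)
    show "mono f"
    proof (rule monoI)
      fix r s :: ennreal assume "r \<le> s"
      then have "r \<le> 1" if "s \<le> 1"
        using that by (rule order_trans)
      moreover have "r = 0" if "s = 0"
        using that \<open>r \<le> s\<close> by simp
      ultimately show "f r \<le> f s"
        using p unfolding f_def by (simp split: if_split)
    qed
    show "range f \<subseteq> {0..1}" "f 0 = 0" "f top = 1"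
      using p by (auto simp: f_def top_unique)
    fix x :: ennreal and c assume "0 < x" "x < top" "c < f x"
    show "\<exists>y<x. c < f y"
    proof (cases "x \<le> 1")
      case True
      obtain y where "0 < y" "y < x" using \<open>0 < x\<close> dense by blast
      then show ?thesis
        using True \<open>c < f x\<close> by (intro exI[of _ y]) (auto simp: f_def split: if_splits)
    next
      case False
      then have "1 < x" by simp
      then obtain y where "1 < y" "y < x" using dense by blast
      then show ?thesis
        using False \<open>c < f x\<close> by (intro exI[of _ y]) (auto simp: f_def split: if_splits)
    qed
  next
    fix c :: real assume "c < 1"
    then show "\<exists>x<top. c < f x"
      by (intro exI[of _ 2]) (auto simp: f_def)
  qed
  have fd: "f \<in> ddf" and gd: "g \<in> ddf"
    using f g continuous_ddf_subset nondefective_ddf_subset by auto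
  have section_eq: "T p t = tensor f g (ennreal t)" if t: "t \<in> {0..1}" for t
  proof (rule antisym)
    show "T p t \<le> tensor f g (ennreal t)"
    proof (rule ccontr)
      assume "\<not> T p t \<le> tensor f g (ennreal t)"
      then obtain t' where t': "0 \<le> t'" "t' < t" "tensor f g (ennreal t) < T p t'"
        using T_less_rightE[OF p t tensor_bounds(1)[OF fd gd]] by (metis not_le)
      then have "L 0 (ennreal t') < ennreal t"
        by (simp add: L_zero ennreal_lessI)
      then obtain r where r: "0 < r" "L r (ennreal t') < ennreal t"
        using L_less_rightE by blast
      have "r \<le> ennreal t"
        using L_ge(1)[of r "ennreal t'"] r by simp
      also have "\<dots> \<le> 1"
        using t by simp
      finally have "f r = p"
        using r by (simp add: f_def)
      moreover have "g (ennreal t') = t'"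
        unfolding g_def using t t' by (intro ramp_ddf_unit) auto
      ultimately show False
        using tensor_upper[OF fd gd _ r(2)] t'(3) by simp
    qed
    show "tensor f g (ennreal t) \<le> T p t"
    proof (rule tensor_least[OF fd gd])
      show "0 \<le> T p t"
        using T_bounds[OF p t] by simp
      fix r s assume "L r s < ennreal t"
      then have "r \<le> ennreal t" "s \<le> ennreal t"
        using L_ge[of r s] L_ge[of s r] by auto
      moreover then have "r \<le> 1"
        using t by (intro order_trans[of r "ennreal t" 1]) auto
      ultimately have "f r \<le> p" "g s \<le> g (ennreal t)"
        using p ddf_mono[OF gd] by (auto simp: f_def)
      moreover have "g (ennreal t) = t"
        unfolding g_def using t by (intro ramp_ddf_unit) auto
      ultimately show "T (f r) (g s) \<le> T p t"
        using p t ddf_bounds[OF fd, of r] ddf_bounds[OF gd, of s] by (intro T_mono) auto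
    qed simp
  qed
  have "continuous_on UNIV (tensor f g)"
    using cont[OF f g] by (simp add: continuous_ddf_def)
  then have "continuous_on {0..1} (\<lambda>t. tensor f g (ennreal t))"
    by (rule continuous_on_compose2) (auto intro!: continuous_on_ennreal continuous_on_id)
  then show "continuous_on {0..1} (T p)"
    by (rule continuous_on_cong[THEN iffD1, rotated -1]) (auto simp: section_eq)
qed

end

section \<open>Characterisation\<close>

theorem theorem4p9:
  fixes T :: "real \<Rightarrow> real \<Rightarrow> real" and L :: "ennreal \<Rightarrow> ennreal \<Rightarrow> ennreal"
  assumes "left_continuous_t_norm T" and "right_continuous_t_conorm L"
  shows "((\<forall>f\<in>nondefective_ddf. \<forall>g\<in>continuous_ddf. tensor_op L T f g \<in> continuous_ddf)
            \<longleftrightarrow> continuous_t_norm T \<and> cancellation_law L) \<and>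
         (continuous_t_norm T \<and> cancellation_law L \<longrightarrow>
            semigroup_ideal continuous_ddf nondefective_ddf (tensor_op L T))"
proof -
  interpret tensor_product T L
    using assms by unfold_locales
  show ?thesis
    using tensor_continuous continuous_ddf_ideal cancellation_if_tensor_continuous
      T_continuous_if_tensor_continuous
    by blast
qed

end
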